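(* Let $(\alpha_i,\beta_i)$, $i\ge1$, be an arbitrary interval from the representation $$\{t\ge0\mid Y(t)>0\}=[\alpha_0,\beta_0)\cup\Big(\bigcup_{i=1}^N(\alpha_i,\beta_i)\Big)$$ of the positivity set of $Y$. Then: 1) $\lim_{t\to\alpha_i+}Y(t)=0$ and $\lim_{t\to\beta_i-}Y(t)=0$ almost surely; 2) for any $t\in[\alpha_i,\beta_i]$, $$Y(t)=\int_{\alpha_i}^t\frac{k}{Y(s)}\,ds-a\int_{\alpha_i}^tY(s)\,ds+\sigma\big(B^H(t)-B^H(\alpha_i)\big)\quad\text{almost surely}.$$
   Context: $B^H=\{B^H(t),t\ge0\}$ is a fractional Brownian motion with Hurst index $H\in(0,1/2)$ on a probability space $(\Omega,\mathcal F,\mathbb P)$, i.e. a centered Gaussian process with covariance $\mathbb E[B^H(t)B^H(s)]=\frac12(t^{2H}+s^{2H}-|t-s|^{2H})$ and continuous paths starting at $0$. $Y_0,k,a,\sigma>0$ are constants. For $\varepsilon>0$, $Y_\varepsilon=\{Y_\varepsilon(t),t\ge0\}$ is the unique (pathwise, continuous) solution of $$Y_\varepsilon(t)=Y_0+\int_0^t\frac{k}{Y_\varepsilon(s)\mathbf 1_{\{Y_\varepsilon(s)>0\}}+\varepsilon}\,ds-a\int_0^tY_\varepsilon(s)\,ds+\sigma B^H(t),\quad t\ge0.$$ $Y_\varepsilon(t)$ increases as $\varepsilon$ decreases, and $Y(t)=\lim_{\varepsilon\downarrow0}Y_\varepsilon(t)$, $t\ge0$, is the pointwise limit. Only finite and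 locally Lebesgue integrable paths of $Y$ are considered (this excludes only a null set). Almost surely $Y\ge0$, $Y>0$ a.e., and the set $\{t>0\mid Y(t)>0\}$ is open in $\mathbb R$; hence the positivity set is a.s. represented as $$\{t\ge0\mid Y(t)>0\}=[\alpha_0,\beta_0)\cup\Big(\bigcup_{i=1}^N(\alpha_i,\beta_i)\Big),\qquad N\in\mathbb N\cup\{\infty\},$$ where $\alpha_0=0$, $\beta_0$ is the first moment at which $Y$ hits zero, and the (random, pathwise defined) intervals $(\alpha_i,\beta_i)$, $i\ge1$, are pairwise disjoint and disjoint from $[\alpha_0,\beta_0)$ (they are the connected components of the positivity set). The endpoints are treated as real (finite) numbers. *)

theory Defs
  imports "HOL-Probability.Probability"
begin

text \<open>Degenerate (almost surely constant) variables count as Gaussian.\<close>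

definition gaussian_rv :: "'w measure \<Rightarrow> ('w \<Rightarrow> real) \<Rightarrow> bool" where
  "gaussian_rv M X \<longleftrightarrow> X \<in> borel_measurable M \<and>
     ((\<exists>\<mu> s. 0 < s \<and> distributed M lborel X (\<lambda>x. ennreal (normal_density \<mu> s x))) \<or>
      (\<exists>\<mu>. AE \<omega> in M. X \<omega> = \<mu>))"

text \<open>A family is jointly Gaussian iff all its finite linear combinations are Gaussian.\<close>

definition gaussian_process :: "'w measure \<Rightarrow> 't set \<Rightarrow> ('t \<Rightarrow> 'w \<Rightarrow> real) \<Rightarrow> bool" where
  "gaussian_process M T X \<longleftrightarrow>
     (\<forall>F c. finite F \<and> F \<subseteq> T \<longrightarrow> gaussian_rv M (\<lambda>\<omega>. \<Sum>t\<in>F. c t * X t \<omega>))"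

definition fractional_brownian_motion ::
  "'w measure \<Rightarrow> real \<Rightarrow> (real \<Rightarrow> 'w \<Rightarrow> real) \<Rightarrow> bool" where
  "fractional_brownian_motion M H B \<longleftrightarrow>
     gaussian_process M {0..} B \<and>
     (\<forall>t\<ge>0. integral\<^sup>L M (B t) = 0) \<and>
     (\<forall>t\<ge>0. \<forall>s\<ge>0. (\<integral>\<omega>. B t \<omega> * B s \<omega> \<partial>M) =
        (t powr (2 * H) + s powr (2 * H) - \<bar>t - s\<bar> powr (2 * H)) / 2) \<and>
     (\<forall>\<omega>\<in>space M. continuous_on {0..} (\<lambda>t. B t \<omega>) \<and> B 0 \<omega> = 0)"

definition eps_solution ::
  "real \<Rightarrow> real \<Rightarrow> real \<Rightarrow> real \<Rightarrow> real \<Rightarrow> (real \<Rightarrow> real) \<Rightarrow> (real \<Rightarrow> real) \<Rightarrow> bool" where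
  "eps_solution Y0 k a \<sigma> \<epsilon> b y \<longleftrightarrow>
     continuous_on {0..} y \<and>
     (\<forall>t\<ge>0. y t = Y0
        + (LBINT s:{0..t}. k / (y s * indicator {0<..} (y s) + \<epsilon>))
        - a * (LBINT s:{0..t}. y s)
        + \<sigma> * b t)"

definition positivity_set :: "(real \<Rightarrow> real) \<Rightarrow> real set" where
  "positivity_set y = {t. 0 \<le> t \<and> 0 < y t}"

text \<open>
  The interval \<open>(\<alpha>,\<beta>)\<close> with finite endpoints is a connected component of the positivity set.
  When \<open>y 0 > 0\<close>, the component containing \<open>0\<close> has the form \<open>[0,\<beta>)\<close>; it is not an open
  interval and is therefore excluded. Components are nonempty, so \<open>\<alpha> < \<beta>\<close>.
\<close>

definition positivity_interval :: "(real \<Rightarrow> real) \<Rightarrow> real \<Rightarrow> real \<Rightarrow> bool" where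
  "positivity_interval y \<alpha> \<beta> \<longleftrightarrow> {\<alpha><..<\<beta>} \<in> components (positivity_set y)"

end

theory Submission
  imports Defs
begin

text \<open>
  Everything is pathwise. The drift \<open>k / (x\<^sup>+ + \<epsilon>) - a * x\<close> decreases in \<open>x\<close> and in \<open>\<epsilon>\<close>, so the
  penalised paths increase as \<open>\<epsilon>\<close> decreases and \<open>Y\<close> is lower semicontinuous; near a point of
  positivity they stay away from zero uniformly in \<open>\<epsilon>\<close>, the drift is bounded, and the integral
  equation passes to the limit between any two nearby times. At an endpoint \<open>Y\<close> vanishes. It cannot
  jump upwards after \<open>\<alpha>\<close>: to climb from \<open>\<eta> / 4\<close> to \<open>\<eta> / 2\<close> the penalised paths have
  only a drift of at most \<open>4 * k / \<eta>\<close> and the noise at their disposal. It cannot jump downwards at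
  \<open>\<beta>\<close>, because the drift is bounded below. Hence \<open>Y\<close> is continuous on \<open>[\<alpha>, \<beta>]\<close>, and the
  fundamental theorem of calculus for \<open>Y - \<sigma> * b\<close>, with derivative only in the interior, gives
  both the equation and the integrability of \<open>k / Y\<close>.
\<close>

section \<open>Last passage times, and the endpoints of a component\<close>

text \<open>After its last visit to a level a path stays on one side of it, so on the whole
  remaining time interval the drift obeys a single bound. The visit is the supremum of the closed
  set where \<open>f\<close> is at most \<open>c\<close>.\<close>

lemma last_passage_below:
  fixes f :: "real \<Rightarrow> real"
  assumes "continuous_on {s..t} f" "s \<le> t" "f s \<le> c" "c < f t"
  obtains u where "s \<le> u" "u \<le> t" "f u = c" "\<And>r. u \<le> r \<Longrightarrow> r \<le> t \<Longrightarrow> c \<le> f r"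
proof -
  define A where "A = {r \<in> {s..t}. f r \<le> c}"
  have cl: "closed A"
    unfolding A_def using assms(1) by (intro continuous_on_closed_Collect_le) auto
  have ne: "A \<noteq> {}" and bdd: "bdd_above A"
    using assms by (auto simp: A_def intro!: bdd_aboveI[of _ t])
  define u where "u = Sup A"
  have uA: "u \<in> A"
    unfolding u_def by (rule closed_contains_Sup[OF ne bdd cl])
  then have u: "s \<le> u" "u \<le> t" "f u \<le> c" by (auto simp: A_def)
  have above: "c < f r" if "u < r" "r \<le> t" for r
  proof (rule ccontr)
    assume "\<not> c < f r"
    then have "r \<in> A" using that u by (auto simp: A_def)
    then have "r \<le> u" unfolding u_def using bdd by (rule cSup_upper)
    with that show False by simp
  qed
  have "f u = c"
  proof -
    have "u \<noteq> t" using u assms by auto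
    have "continuous_on {u..t} f" using assms(1) u by (rule_tac continuous_on_subset) auto
    \<comment> \<open>The level is attained somewhere in \<open>{u..t}\<close>; since
      \<open>f\<close> exceeds \<open>c\<close> strictly after \<open>u\<close>, it can only be
      attained at \<open>u\<close>.\<close>
    then obtain x where x: "u \<le> x" "x \<le> t" "f x = c"
      using IVT'[of f u c t] u assms by auto
    with above[of x] show ?thesis by (cases "x = u") auto
  qed
  moreover have "c \<le> f r" if "u \<le> r" "r \<le> t" for r
    using above[of r] that \<open>f u = c\<close> by (cases "r = u") auto
  ultimately show ?thesis using that u by blast
qed

lemma last_passage_above:
  fixes f :: "real \<Rightarrow> real"
  assumes "continuous_on {s..t} f" "s \<le> t" "c \<le> f s" "f t < c"
  obtains u where "s \<le> u" "u \<le> t" "f u = c" "\<And>r. u \<le> r \<Longrightarrow> r \<le> t \<Longrightarrow> f r \<le> c"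
proof -
  have "continuous_on {s..t} (\<lambda>r. - f r)" using assms(1) by (intro continuous_intros)
  then show ?thesis
    using last_passage_below[of s t "\<lambda>r. - f r" "- c"] assms that by auto
qed

text \<open>If \<open>y\<close> were positive at an endpoint, a closed interval from that endpoint
  to an inner point \<open>x\<close> would be a connected part of the positivity set meeting the
  component, so maximality would put the endpoint inside the open interval.\<close>

lemma positivity_intervalD:
  assumes "positivity_interval y \<alpha> \<beta>"
  shows "0 \<le> \<alpha>" "\<alpha> < \<beta>" "\<And>t. \<alpha> < t \<Longrightarrow> t < \<beta> \<Longrightarrow> 0 < y t" "y \<alpha> \<le> 0" "y \<beta> \<le> 0"
proof -
  let ?P = "positivity_set y"
  have comp: "{\<alpha><..<\<beta>} \<in> components ?P" using assms by (simp add: positivity_interval_def)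
  have ne: "\<alpha> < \<beta>" using in_components_nonempty[OF comp] by auto
  have sub: "{\<alpha><..<\<beta>} \<subseteq> ?P" using in_components_subset[OF comp] .
  show "\<alpha> < \<beta>" by fact
  show pos: "\<And>t. \<alpha> < t \<Longrightarrow> t < \<beta> \<Longrightarrow> 0 < y t" using sub by (auto simp: positivity_set_def)
  show nonneg: "0 \<le> \<alpha>"
  proof (rule ccontr)
    assume "\<not> 0 \<le> \<alpha>"
    then obtain x where "\<alpha> < x" "x < min 0 \<beta>" using dense[of \<alpha> "min 0 \<beta>"] ne by auto
    with sub show False by (auto simp: positivity_set_def)
  qed
  have maximal: "T \<subseteq> {\<alpha><..<\<beta>}" if "connected T" "T \<subseteq> ?P" "{\<alpha><..<\<beta>} \<inter> T \<noteq> {}" for T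
    using components_maximal[OF comp that] .
  obtain x where x: "\<alpha> < x" "x < \<beta>" using dense[OF ne] by auto
  show "y \<alpha> \<le> 0"
  proof (rule ccontr)
    assume "\<not> y \<alpha> \<le> 0"
    then have "0 < y z" if "z \<in> {\<alpha>..x}" for z
      using pos[of z] that x by (cases "z = \<alpha>") auto
    then have "{\<alpha>..x} \<subseteq> ?P" using nonneg x by (auto simp: positivity_set_def)
    then have "{\<alpha>..x} \<subseteq> {\<alpha><..<\<beta>}" using x by (intro maximal) auto
    then have "\<alpha> \<in> {\<alpha><..<\<beta>}" by (rule subsetD) (use x in simp)
    then show False by simp
  qed
  show "y \<beta> \<le> 0"
  proof (rule ccontr)
    assume "\<not> y \<beta> \<le> 0"
    then have "0 < y z" if "z \<in> {x..\<beta>}" for z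
      using pos[of z] that x by (cases "z = \<beta>") auto
    then have "{x..\<beta>} \<subseteq> ?P" using nonneg x by (auto simp: positivity_set_def)
    then have "{x..\<beta>} \<subseteq> {\<alpha><..<\<beta>}" using x by (intro maximal) auto
    then have "\<beta> \<in> {\<alpha><..<\<beta>}" by (rule subsetD) (use x in simp)
    then show False by simp
  qed
qed

section \<open>The penalised equation along one fixed noise path\<close>

locale penalised_path =
  fixes k a \<sigma> Y0 :: real and b :: "real \<Rightarrow> real" and y :: "real \<Rightarrow> real \<Rightarrow> real" and Y :: "real \<Rightarrow> real"
  assumes k: "0 < k" and a: "0 < a" and \<sigma>: "0 < \<sigma>" and Y0: "0 < Y0"
    and b: "continuous_on {0..} b" and b0: "b 0 = 0"
    and sol: "\<And>\<epsilon>. 0 < \<epsilon> \<Longrightarrow> eps_solution Y0 k a \<sigma> \<epsilon> b (y \<epsilon>)"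
    and lim: "\<And>t. 0 \<le> t \<Longrightarrow> ((\<lambda>\<epsilon>. y \<epsilon> t) \<longlongrightarrow> Y t) (at_right 0)"
begin

text \<open>\<open>max x 0\<close> equals the product \<open>x * indicator {0<..} x\<close> of
  \<open>eps_solution\<close>, in a form that shows continuity and monotonicity.\<close>

definition drift :: "real \<Rightarrow> real \<Rightarrow> real" where
  "drift \<epsilon> x = k / (max x 0 + \<epsilon>) - a * x"

lemma drift_antimono:
  assumes "0 < \<epsilon>" "\<epsilon> \<le> \<epsilon>'" "x \<le> x'"
  shows "drift \<epsilon>' x' \<le> drift \<epsilon> x"
  unfolding drift_def using assms k a
  by (intro diff_mono divide_left_mono mult_pos_pos mult_left_mono add_mono) auto

text \<open>At distance \<open>c\<close> from zero the singular term is at most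
  \<open>k / c\<close>, uniformly in \<epsilon>. The lower bound \<open>drift_ge\<close> asks only
  that the path be bounded above, so it remains available where paths come close to zero; hence the
  different arguments at the two endpoints.\<close>

lemma drift_le:
  assumes "0 < \<epsilon>" "0 < c" "c \<le> x"
  shows "drift \<epsilon> x \<le> k / c"
proof -
  have "k / (max x 0 + \<epsilon>) \<le> k / c"
    using assms k by (intro divide_left_mono mult_pos_pos) auto
  moreover have "0 \<le> a * x" using assms a by simp
  ultimately show ?thesis by (simp add: drift_def)
qed

lemma drift_ge:
  assumes "0 < \<epsilon>" "x \<le> K"
  shows "- (a * K) \<le> drift \<epsilon> x"
proof -
  have "0 \<le> k / (max x 0 + \<epsilon>)" using assms k by simp
  moreover have "a * x \<le> a * K" using assms a by simp
  ultimately show ?thesis by (simp add: drift_def)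
qed

lemma y_cont: "0 < \<epsilon> \<Longrightarrow> continuous_on {0..} (y \<epsilon>)"
  using sol by (auto simp: eps_solution_def)

lemma y_cont_on: "0 < \<epsilon> \<Longrightarrow> 0 \<le> s \<Longrightarrow> continuous_on {s..t} (y \<epsilon>)"
  by (rule continuous_on_subset[OF y_cont]) auto

lemma b_cont_on: "0 \<le> s \<Longrightarrow> continuous_on {s..t} b"
  by (rule continuous_on_subset[OF b]) auto

lemma drift_cont_on:
  assumes "0 < \<epsilon>" "0 \<le> s"
  shows "continuous_on {s..t} (\<lambda>r. drift \<epsilon> (y \<epsilon> r))"
proof -
  have "max x 0 + \<epsilon> \<noteq> 0" for x :: real
    using assms(1) by (simp add: add_nonneg_pos less_imp_neq[symmetric])
  then show ?thesis
    unfolding drift_def by (intro continuous_intros y_cont_on assms) auto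
qed

text \<open>The integrands are continuous, so the Lebesgue integrals agree with Henstock-Kurzweil
  integrals and merge into one integral of the drift.\<close>

lemma y_eq:
  assumes "0 < \<epsilon>" "0 \<le> t"
  shows "y \<epsilon> t = Y0 + integral {0..t} (\<lambda>r. drift \<epsilon> (y \<epsilon> r)) + \<sigma> * b t"
proof -
  have max: "x * indicator {0<..} x = max x 0" for x :: real
    by (auto simp: indicator_def)
  have pos: "max x 0 + \<epsilon> \<noteq> 0" for x :: real
    using assms(1) by (simp add: add_nonneg_pos less_imp_neq[symmetric])
  have c1: "continuous_on {0..t} (\<lambda>r. k / (max (y \<epsilon> r) 0 + \<epsilon>))"
    using pos by (intro continuous_intros y_cont_on assms) auto
  have c2: "continuous_on {0..t} (y \<epsilon>)"
    by (intro y_cont_on assms) auto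
  have "y \<epsilon> t = Y0 + (LBINT r:{0..t}. k / (max (y \<epsilon> r) 0 + \<epsilon>)) - a * (LBINT r:{0..t}. y \<epsilon> r) + \<sigma> * b t"
    using sol[OF assms(1)] assms(2) by (simp only: eps_solution_def max)
  also have "(LBINT r:{0..t}. k / (max (y \<epsilon> r) 0 + \<epsilon>)) = integral {0..t} (\<lambda>r. k / (max (y \<epsilon> r) 0 + \<epsilon>))"
    by (rule set_borel_integral_eq_integral(2)[OF borel_integrable_atLeastAtMost'[OF c1]])
  also have "(LBINT r:{0..t}. y \<epsilon> r) = integral {0..t} (y \<epsilon>)"
    by (rule set_borel_integral_eq_integral(2)[OF borel_integrable_atLeastAtMost'[OF c2]])
  also have "a * integral {0..t} (y \<epsilon>) = integral {0..t} (\<lambda>r. a * y \<epsilon> r)"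
    by simp
  finally show ?thesis
    unfolding drift_def
    using integral_diff[OF integrable_continuous_real[OF c1]
        integrable_continuous_real[OF continuous_on_mult_left[OF c2, of a]]]
    by simp
qed

lemma y_zero: "0 < \<epsilon> \<Longrightarrow> y \<epsilon> 0 = Y0"
  using y_eq[of \<epsilon> 0] b0 by simp

lemma y_increment:
  assumes "0 < \<epsilon>" "0 \<le> s" "s \<le> t"
  shows "y \<epsilon> t - y \<epsilon> s = integral {s..t} (\<lambda>r. drift \<epsilon> (y \<epsilon> r)) + \<sigma> * (b t - b s)"
proof -
  have "integral {0..s} (\<lambda>r. drift \<epsilon> (y \<epsilon> r)) + integral {s..t} (\<lambda>r. drift \<epsilon> (y \<epsilon> r))
      = integral {0..t} (\<lambda>r. drift \<epsilon> (y \<epsilon> r))"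
    using assms
    by (intro Henstock_Kurzweil_Integration.integral_combine integrable_continuous_real drift_cont_on) auto
  then show ?thesis
    using y_eq[of \<epsilon> s] y_eq[of \<epsilon> t] assms by (simp add: algebra_simps)
qed

lemma y_increment_le:
  assumes "0 < \<epsilon>" "0 \<le> s" "s \<le> t" "\<And>r. s \<le> r \<Longrightarrow> r \<le> t \<Longrightarrow> drift \<epsilon> (y \<epsilon> r) \<le> D"
  shows "y \<epsilon> t - y \<epsilon> s \<le> D * (t - s) + \<sigma> * (b t - b s)"
proof -
  have "integral {s..t} (\<lambda>r. drift \<epsilon> (y \<epsilon> r)) \<le> integral {s..t} (\<lambda>r. D)"
    using assms by (intro integral_le integrable_continuous_real drift_cont_on) auto
  then show ?thesis using y_increment[OF assms(1-3)] assms(3) by (simp add: mult.commute)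
qed

lemma y_increment_ge:
  assumes "0 < \<epsilon>" "0 \<le> s" "s \<le> t" "\<And>r. s \<le> r \<Longrightarrow> r \<le> t \<Longrightarrow> D \<le> drift \<epsilon> (y \<epsilon> r)"
  shows "D * (t - s) + \<sigma> * (b t - b s) \<le> y \<epsilon> t - y \<epsilon> s"
proof -
  have "integral {s..t} (\<lambda>r. D) \<le> integral {s..t} (\<lambda>r. drift \<epsilon> (y \<epsilon> r))"
    using assms by (intro integral_le integrable_continuous_real drift_cont_on) auto
  then show ?thesis using y_increment[OF assms(1-3)] assms(3) by (simp add: mult.commute)
qed

section \<open>Comparison in \<epsilon>\<close>

text \<open>Both paths start at \<open>Y0\<close>. If they end in the wrong order, consider the time
  since they last met: there the path for \<epsilon> lies below the other, so both its position and
  its smaller parameter give it the larger drift. The noise cancels, and the path cannot have fallen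
  behind.\<close>

lemma y_antimono:
  assumes "0 < \<epsilon>" "\<epsilon> \<le> \<epsilon>'" "0 \<le> t"
  shows "y \<epsilon>' t \<le> y \<epsilon> t"
proof (rule ccontr)
  assume "\<not> ?thesis"
  then have neg: "y \<epsilon> t - y \<epsilon>' t < 0" by simp
  have "continuous_on {0..t} (\<lambda>r. y \<epsilon> r - y \<epsilon>' r)"
    using assms by (intro continuous_intros y_cont_on) auto
  moreover have "0 \<le> y \<epsilon> 0 - y \<epsilon>' 0" using assms by (simp add: y_zero)
  ultimately obtain u where u: "0 \<le> u" "u \<le> t" "y \<epsilon> u - y \<epsilon>' u = 0"
    "\<And>r. u \<le> r \<Longrightarrow> r \<le> t \<Longrightarrow> y \<epsilon> r - y \<epsilon>' r \<le> 0"
    using last_passage_above[of 0 t "\<lambda>r. y \<epsilon> r - y \<epsilon>' r" 0] neg assms by blast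
  have "integral {u..t} (\<lambda>r. drift \<epsilon>' (y \<epsilon>' r)) \<le> integral {u..t} (\<lambda>r. drift \<epsilon> (y \<epsilon> r))"
    using assms u(1,2) u(4)
    by (intro integral_le integrable_continuous_real drift_cont_on drift_antimono) auto
  then have "y \<epsilon>' t - y \<epsilon>' u \<le> y \<epsilon> t - y \<epsilon> u"
    using y_increment[of \<epsilon> u t] y_increment[of \<epsilon>' u t] assms u by simp
  with u(3) neg show False by simp
qed

lemma y_le_Y:
  assumes "0 < \<epsilon>" "0 \<le> t"
  shows "y \<epsilon> t \<le> Y t"
proof (rule tendsto_lowerbound[OF lim])
  show "\<forall>\<^sub>F \<delta> in at_right 0. y \<epsilon> t \<le> y \<delta> t"
    unfolding eventually_at_right_field
    using assms by (intro exI[of _ \<epsilon>]) (auto intro: y_antimono)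
qed (use assms in auto)

lemma Y_le:
  assumes "0 \<le> t" "\<And>\<epsilon>. 0 < \<epsilon> \<Longrightarrow> y \<epsilon> t \<le> C"
  shows "Y t \<le> C"
proof (rule tendsto_upperbound[OF lim])
  show "\<forall>\<^sub>F \<epsilon> in at_right 0. y \<epsilon> t \<le> C"
    using assms(2) by (auto simp: eventually_at_right_field intro: exI[of _ 1])
qed (use assms in auto)

section \<open>Bounds uniform in \<epsilon>, and nonnegativity of the limit\<close>

lemma b_bounded:
  obtains K where "0 < K" "\<And>t. 0 \<le> t \<Longrightarrow> t \<le> T \<Longrightarrow> \<bar>b t\<bar> \<le> K"
proof -
  have "compact (b ` {0..T})" by (intro compact_continuous_image b_cont_on) auto
  then obtain K where "0 < K" "\<forall>x\<in>b ` {0..T}. norm x \<le> K"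
    using compact_imp_bounded bounded_pos by blast
  then show ?thesis using that by auto
qed

lemma b_continuity:
  assumes "0 \<le> t" "0 < \<eta>"
  obtains \<delta> where "0 < \<delta>" "\<And>r. 0 \<le> r \<Longrightarrow> \<bar>r - t\<bar> < \<delta> \<Longrightarrow> \<sigma> * \<bar>b r - b t\<bar> < \<eta>"
proof -
  have "0 < \<eta> / \<sigma>" using assms \<sigma> by simp
  with b assms(1) obtain \<delta> where "0 < \<delta>" "\<forall>r\<in>{0..}. dist r t < \<delta> \<longrightarrow> dist (b r) (b t) < \<eta> / \<sigma>"
    unfolding continuous_on_iff by (metis atLeast_iff)
  then show ?thesis using that[of \<delta>] \<sigma> by (auto simp: dist_real_def field_simps)
qed

text \<open>Since the last passage through the level \<open>m\<close> the drift has been at most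
  \<open>k\<close>, so the excess over \<open>m\<close> is at most \<open>k\<close> times the
  elapsed time plus the oscillation of the noise, whatever \<epsilon> is.\<close>

lemma y_bounded_above:
  obtains K where "0 < K" "\<And>\<epsilon> t. 0 < \<epsilon> \<Longrightarrow> 0 \<le> t \<Longrightarrow> t \<le> T \<Longrightarrow> y \<epsilon> t \<le> K"
proof -
  obtain C where C: "0 < C" "\<And>t. 0 \<le> t \<Longrightarrow> t \<le> T \<Longrightarrow> \<bar>b t\<bar> \<le> C"
    using b_bounded[of T] by blast
  \<comment> \<open>At least 1 so that the drift above this level is at most \<open>k\<close>; at
    least \<open>Y0\<close> so that every path starts at or below it.\<close>
  define m where "m = max 1 Y0"
  define K where "K = m + k * \<bar>T\<bar> + \<sigma> * (2 * C)"
  have "0 \<le> k * \<bar>T\<bar>" "0 < \<sigma> * (2 * C)" using k \<sigma> C(1) by auto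
  then have "m \<le> K" "0 < K" unfolding K_def m_def by linarith+
  moreover have "y \<epsilon> t \<le> K" if t: "0 < \<epsilon>" "0 \<le> t" "t \<le> T" for \<epsilon> t
  proof (rule ccontr)
    assume "\<not> y \<epsilon> t \<le> K"
    then have gt: "K < y \<epsilon> t" "m < y \<epsilon> t" using \<open>m \<le> K\<close> by auto
    have "y \<epsilon> 0 \<le> m" using that by (simp add: y_zero m_def)
    then obtain u where u: "0 \<le> u" "u \<le> t" "y \<epsilon> u = m" "\<And>r. u \<le> r \<Longrightarrow> r \<le> t \<Longrightarrow> m \<le> y \<epsilon> r"
      using last_passage_below[of 0 t "y \<epsilon>" m] gt t y_cont_on[of \<epsilon> 0 t] by auto
    have "drift \<epsilon> (y \<epsilon> r) \<le> k" if "u \<le> r" "r \<le> t" for r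
      using drift_le[of \<epsilon> 1 "y \<epsilon> r"] u(4)[OF that] \<open>0 < \<epsilon>\<close> by (simp add: m_def)
    then have "y \<epsilon> t - m \<le> k * (t - u) + \<sigma> * (b t - b u)"
      using y_increment_le[of \<epsilon> u t k] u that by auto
    also have "\<dots> \<le> k * \<bar>T\<bar> + \<sigma> * (2 * C)"
      using C(2)[of t] C(2)[of u] u that k \<sigma> by (intro add_mono mult_left_mono) auto
    finally show False using gt by (simp add: K_def)
  qed
  ultimately show ?thesis using that by blast
qed

text \<open>While the penalised path is below \<open>-\<delta>\<close>, its drift is at least \<open>k / \<epsilon>\<close>, so it can stay there
  only for a time of order \<open>\<epsilon>\<close>, during which the noise hardly moves.\<close>

lemma Y_nonneg:
  assumes t: "0 \<le> t"
  shows "0 \<le> Y t"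
proof (rule ccontr)
  assume "\<not> 0 \<le> Y t"
  define \<delta> where "\<delta> = - Y t / 2"
  have \<delta>: "0 < \<delta>" using \<open>\<not> 0 \<le> Y t\<close> by (simp add: \<delta>_def)
  obtain \<eta> where \<eta>: "0 < \<eta>" "\<And>r. 0 \<le> r \<Longrightarrow> \<bar>r - t\<bar> < \<eta> \<Longrightarrow> \<sigma> * \<bar>b r - b t\<bar> < \<delta>"
    using b_continuity[OF t \<delta>] by blast
  obtain C where C: "0 < C" "\<And>r. 0 \<le> r \<Longrightarrow> r \<le> t \<Longrightarrow> \<bar>b r\<bar> \<le> C"
    using b_bounded[of t] by blast
  \<comment> \<open>By \<open>y_le_Y\<close> every penalised path is at most
    \<open>- 2 * \<delta>\<close> at \<open>t\<close>, so \<epsilon> may be fixed now. With this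
    value, drift \<open>k / \<epsilon>\<close> over a time \<eta> contributes exactly
    \<open>\<sigma> * (2 * C)\<close>, the largest possible fall of the noise term.\<close>
  define \<epsilon> where "\<epsilon> = k * \<eta> / (\<sigma> * (2 * C))"
  have \<epsilon>: "0 < \<epsilon>" using k \<sigma> C \<eta> by (simp add: \<epsilon>_def)
  have yt: "y \<epsilon> t \<le> - 2 * \<delta>" using y_le_Y[OF \<epsilon> t] by (simp add: \<delta>_def)
  have "- \<delta> \<le> y \<epsilon> 0" using y_zero[OF \<epsilon>] Y0 \<delta> by simp
  moreover have "y \<epsilon> t < - \<delta>" using yt \<delta> by simp
  ultimately obtain u where u: "0 \<le> u" "u \<le> t" "y \<epsilon> u = - \<delta>"
    "\<And>r. u \<le> r \<Longrightarrow> r \<le> t \<Longrightarrow> y \<epsilon> r \<le> - \<delta>"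
    using last_passage_above[of 0 t "y \<epsilon>" "- \<delta>"] t y_cont_on[of \<epsilon> 0 t] \<epsilon> by auto
  have "k / \<epsilon> \<le> drift \<epsilon> (y \<epsilon> r)" if "u \<le> r" "r \<le> t" for r
  proof -
    have "y \<epsilon> r \<le> 0" using u(4)[OF that] \<delta> by simp
    then show ?thesis
      using a by (simp add: drift_def max_def mult_nonneg_nonpos)
  qed
  then have le: "k / \<epsilon> * (t - u) + \<sigma> * (b t - b u) \<le> - \<delta>"
    using y_increment_ge[of \<epsilon> u t "k / \<epsilon>"] \<epsilon> u yt by auto
  have drift_nonneg: "0 \<le> k / \<epsilon> * (t - u)" using k \<epsilon> u by simp
  have "\<sigma> * (b u - b t) \<le> \<sigma> * \<bar>b u - b t\<bar>" using \<sigma> by simp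
  \<comment> \<open>By \<open>le\<close> the noise term must fall by at least \<delta> from
    \<open>u\<close> to \<open>t\<close>, which it cannot do within a time shorter than
    \<eta>.\<close>
  then have "\<not> \<bar>u - t\<bar> < \<eta>"
    using \<eta>(2)[of u] u(1) le drift_nonneg by (auto simp: algebra_simps)
  then have "k / \<epsilon> * \<eta> \<le> k / \<epsilon> * (t - u)" using k \<epsilon> u by (intro mult_left_mono) auto
  moreover have "k / \<epsilon> * \<eta> = \<sigma> * (2 * C)"
    using k \<sigma> C \<eta> by (simp add: \<epsilon>_def)
  moreover have "\<sigma> * (b u - b t) \<le> \<sigma> * (2 * C)"
    using C(2)[of u] C(2)[of t] u t \<sigma> by (intro mult_left_mono) auto
  ultimately show False using le \<delta> by (simp add: algebra_simps)
qed

section \<open>The limit near a point of positivity\<close>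

text \<open>A single penalised path that is positive at \<open>x\<close> stays above half of its
  value there on a neighbourhood, by continuity. Monotonicity hands this bound to all smaller
  parameters and to \<open>Y\<close>.\<close>

lemma Y_locally_bounded_below:
  assumes "0 < x" "0 < Y x"
  obtains c \<delta> \<epsilon>0 where "0 < c" "0 < \<delta>" "\<delta> < x" "0 < \<epsilon>0"
    "\<And>\<epsilon> r. 0 < \<epsilon> \<Longrightarrow> \<epsilon> \<le> \<epsilon>0 \<Longrightarrow> \<bar>r - x\<bar> \<le> \<delta> \<Longrightarrow> c \<le> y \<epsilon> r"
    "\<And>r. \<bar>r - x\<bar> \<le> \<delta> \<Longrightarrow> c \<le> Y r"
proof -
  have "\<forall>\<^sub>F \<epsilon> in at_right 0. 0 < y \<epsilon> x"
    using order_tendstoD(1)[OF lim] assms by simp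
  then obtain e where e: "0 < e" "\<forall>\<epsilon>>0. \<epsilon> < e \<longrightarrow> 0 < y \<epsilon> x"
    by (auto simp: eventually_at_right_field)
  define \<epsilon>0 where "\<epsilon>0 = e / 2"
  have \<epsilon>0: "0 < \<epsilon>0" and pos: "0 < y \<epsilon>0 x" using e by (auto simp: \<epsilon>0_def)
  define c where "c = y \<epsilon>0 x / 2"
  have c: "0 < c" using pos by (simp add: c_def)
  obtain d where d: "0 < d" "\<forall>r\<in>{0..}. dist r x < d \<longrightarrow> dist (y \<epsilon>0 r) (y \<epsilon>0 x) < c"
    using y_cont[OF \<epsilon>0] c assms unfolding continuous_on_iff by (metis atLeast_iff less_imp_le)
  \<comment> \<open>The halves keep the closed window inside the neighbourhood of radius
    \<open>d\<close> and inside the positive times.\<close>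
  define \<delta> where "\<delta> = min (d / 2) (x / 2)"
  have \<delta>: "0 < \<delta>" "\<delta> < x" "\<delta> < d" using d assms by (auto simp: \<delta>_def)
  have base: "c \<le> y \<epsilon>0 r" if "\<bar>r - x\<bar> \<le> \<delta>" for r
  proof -
    have "0 \<le> r" "\<bar>r - x\<bar> < d" using \<delta> that by auto
    then have "\<bar>y \<epsilon>0 r - y \<epsilon>0 x\<bar> < c" using d(2) by (auto simp: dist_real_def)
    then show ?thesis unfolding c_def by linarith
  qed
  have "c \<le> y \<epsilon> r" if "0 < \<epsilon>" "\<epsilon> \<le> \<epsilon>0" "\<bar>r - x\<bar> \<le> \<delta>" for \<epsilon> r
  proof -
    have "0 \<le> r" using that(3) \<delta>(2) by linarith
    then show ?thesis using base[OF that(3)] y_antimono[OF that(1,2)] by fastforce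
  qed
  moreover have "c \<le> Y r" if "\<bar>r - x\<bar> \<le> \<delta>" for r
  proof -
    have "0 \<le> r" using that \<delta>(2) by linarith
    then show ?thesis using base[OF that] y_le_Y[OF \<epsilon>0] by fastforce
  qed
  ultimately show ?thesis using that[OF c \<delta>(1,2) \<epsilon>0] by blast
qed

text \<open>The lower drift bound is uniform in \<epsilon>, so it survives the limit even if
  \<open>Y\<close> vanishes at \<open>s\<close> or \<open>t\<close>. This rules out downward
  jumps.\<close>

lemma Y_increment_ge:
  assumes "0 \<le> s" "s \<le> t" "t \<le> T" "\<And>\<epsilon> r. 0 < \<epsilon> \<Longrightarrow> 0 \<le> r \<Longrightarrow> r \<le> T \<Longrightarrow> y \<epsilon> r \<le> K"
  shows "- (a * K) * (t - s) + \<sigma> * (b t - b s) \<le> Y t - Y s"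
proof (rule tendsto_lowerbound)
  show "((\<lambda>\<epsilon>. y \<epsilon> t - y \<epsilon> s) \<longlongrightarrow> Y t - Y s) (at_right 0)"
    using assms by (intro tendsto_diff lim) auto
  have "- (a * K) * (t - s) + \<sigma> * (b t - b s) \<le> y \<epsilon> t - y \<epsilon> s" if "0 < \<epsilon>" for \<epsilon>
    using assms that by (intro y_increment_ge drift_ge) auto
  then show "\<forall>\<^sub>F \<epsilon> in at_right 0. - (a * K) * (t - s) + \<sigma> * (b t - b s) \<le> y \<epsilon> t - y \<epsilon> s"
    by (auto simp: eventually_at_right_field intro: exI[of _ 1])
qed auto

text \<open>Near \<open>x\<close> the drift of the paths with small \<epsilon> lies between
  \<open>- (a * K)\<close> and \<open>k / c\<close>, so increments of \<open>Y\<close> are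
  controlled by elapsed time and noise oscillation.\<close>

lemma Y_isCont:
  assumes x: "0 < x" "0 < Y x"
  shows "isCont Y x"
proof -
  obtain c \<delta> \<epsilon>0 where c: "0 < c" "0 < \<delta>" "\<delta> < x" "0 < \<epsilon>0"
    "\<And>\<epsilon> r. 0 < \<epsilon> \<Longrightarrow> \<epsilon> \<le> \<epsilon>0 \<Longrightarrow> \<bar>r - x\<bar> \<le> \<delta> \<Longrightarrow> c \<le> y \<epsilon> r"
    using Y_locally_bounded_below[OF x] by metis
  obtain K where K: "0 < K" "\<And>\<epsilon> t. 0 < \<epsilon> \<Longrightarrow> 0 \<le> t \<Longrightarrow> t \<le> x + \<delta> \<Longrightarrow> y \<epsilon> t \<le> K"
    using y_bounded_above by blast
  have up: "Y t - Y s \<le> k / c * (t - s) + \<sigma> * (b t - b s)"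
    if st: "s \<le> t" "\<bar>s - x\<bar> \<le> \<delta>" "\<bar>t - x\<bar> \<le> \<delta>" for s t
  proof (rule tendsto_upperbound)
    show "((\<lambda>\<epsilon>. y \<epsilon> t - y \<epsilon> s) \<longlongrightarrow> Y t - Y s) (at_right 0)"
      using c(3) st by (intro tendsto_diff lim) auto
    have "y \<epsilon> t - y \<epsilon> s \<le> k / c * (t - s) + \<sigma> * (b t - b s)" if "0 < \<epsilon>" "\<epsilon> < \<epsilon>0" for \<epsilon>
    proof (rule y_increment_le)
      show "0 \<le> s" using st c(3) by linarith
      show "drift \<epsilon> (y \<epsilon> r) \<le> k / c" if "s \<le> r" "r \<le> t" for r
        using that st \<open>0 < \<epsilon>\<close> \<open>\<epsilon> < \<epsilon>0\<close> by (intro drift_le c(1) c(5)) auto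
    qed fact+
    then show "\<forall>\<^sub>F \<epsilon> in at_right 0. y \<epsilon> t - y \<epsilon> s \<le> k / c * (t - s) + \<sigma> * (b t - b s)"
      unfolding eventually_at_right_field using c(4) by (intro exI[of _ \<epsilon>0]) simp
  qed auto
  define D where "D = k / c + a * K"
  have D: "k / c \<le> D" "a * K \<le> D" using k c a K by (auto simp: D_def)
  have osc: "\<bar>Y t - Y s\<bar> \<le> D * (t - s) + \<sigma> * \<bar>b t - b s\<bar>"
    if "s \<le> t" "\<bar>s - x\<bar> \<le> \<delta>" "\<bar>t - x\<bar> \<le> \<delta>" for s t
  proof -
    define P where "P = \<sigma> * (b t - b s)"
    define E where "E = D * (t - s)"
    have "- (a * K) * (t - s) + P \<le> Y t - Y s"
      unfolding P_def using K c(3) that by (intro Y_increment_ge[where T = "x + \<delta>"]) auto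
    moreover have "- E \<le> - (a * K) * (t - s)"
      using mult_right_mono[OF D(2), of "t - s"] that by (simp add: E_def)
    moreover have "k / c * (t - s) \<le> E"
      unfolding E_def by (rule mult_right_mono) (use D that in auto)
    moreover have "\<bar>P\<bar> = \<sigma> * \<bar>b t - b s\<bar>"
      using \<sigma> by (simp add: P_def abs_mult)
    ultimately have "\<bar>Y t - Y s\<bar> \<le> E + \<bar>P\<bar>"
      using up[OF that, folded P_def] by linarith
    then show ?thesis by (simp add: E_def \<open>\<bar>P\<bar> = \<sigma> * \<bar>b t - b s\<bar>\<close>)
  qed
  have "((\<lambda>r. D * \<bar>r - x\<bar> + \<sigma> * \<bar>b r - b x\<bar>) \<longlongrightarrow> D * \<bar>x - x\<bar> + \<sigma> * \<bar>b x - b x\<bar>) (at x)"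
  proof -
    have "continuous_on {0<..} b" by (rule continuous_on_subset[OF b]) auto
    then have "isCont b x" using x by (simp add: continuous_on_eq_continuous_at)
    then have "(b \<longlongrightarrow> b x) (at x)" by (simp add: isCont_def)
    then show ?thesis by (intro tendsto_intros)
  qed
  then have lim0: "((\<lambda>r. D * \<bar>r - x\<bar> + \<sigma> * \<bar>b r - b x\<bar>) \<longlongrightarrow> 0) (at x)" by simp
  have bound: "norm (Y r - Y x) \<le> D * \<bar>r - x\<bar> + \<sigma> * \<bar>b r - b x\<bar>" if "dist r x < \<delta>" for r
    using osc[of r x] osc[of x r] that c(2)
    by (cases "r \<le> x") (auto simp: dist_real_def abs_minus_commute)
  have "((\<lambda>r. Y r - Y x) \<longlongrightarrow> 0) (at x)"
  proof (rule Lim_null_comparison[OF _ lim0])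
    show "\<forall>\<^sub>F r in at x. norm (Y r - Y x) \<le> D * \<bar>r - x\<bar> + \<sigma> * \<bar>b r - b x\<bar>"
      unfolding eventually_at using bound c(2) by blast
  qed
  then show ?thesis by (simp add: isCont_def LIM_zero_iff)
qed

text \<open>Dominated convergence in the increment equation: the same two drift bounds give the
  dominating constant \<open>k / c + a * K\<close>.\<close>

lemma Y_local_equation:
  assumes x: "0 < x" "0 < Y x"
  obtains \<delta> where "0 < \<delta>" "\<delta> < x" "\<And>r. \<bar>r - x\<bar> \<le> \<delta> \<Longrightarrow> 0 < Y r"
    "\<And>s t. s \<le> t \<Longrightarrow> \<bar>s - x\<bar> \<le> \<delta> \<Longrightarrow> \<bar>t - x\<bar> \<le> \<delta> \<Longrightarrow>
       Y t - Y s = integral {s..t} (\<lambda>r. k / Y r - a * Y r) + \<sigma> * (b t - b s)"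
proof -
  obtain c \<delta> \<epsilon>0 where c: "0 < c" "0 < \<delta>" "\<delta> < x" "0 < \<epsilon>0"
    "\<And>\<epsilon> r. 0 < \<epsilon> \<Longrightarrow> \<epsilon> \<le> \<epsilon>0 \<Longrightarrow> \<bar>r - x\<bar> \<le> \<delta> \<Longrightarrow> c \<le> y \<epsilon> r"
    "\<And>r. \<bar>r - x\<bar> \<le> \<delta> \<Longrightarrow> c \<le> Y r"
    using Y_locally_bounded_below[OF x] by metis
  obtain K where K: "0 < K" "\<And>\<epsilon> t. 0 < \<epsilon> \<Longrightarrow> 0 \<le> t \<Longrightarrow> t \<le> x + \<delta> \<Longrightarrow> y \<epsilon> t \<le> K"
    using y_bounded_above by blast
  \<comment> \<open>Dominated convergence works along sequences; this one is positive and never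
    exceeds \<open>\<epsilon>0\<close>, so the lower bound \<open>c\<close> holds for every
    index.\<close>
  define e where "e n = \<epsilon>0 / real (Suc n)" for n
  have e_pos: "0 < e n" and e_le: "e n \<le> \<epsilon>0" for n
    using c(4) divide_left_mono[of 1 "real (Suc n)" \<epsilon>0] by (simp_all add: e_def)
  have e_tendsto: "e \<longlonglongrightarrow> 0"
    using LIMSEQ_Suc[OF lim_const_over_n[of \<epsilon>0]] by (simp add: e_def[abs_def])
  have e_filter: "filterlim e (at_right 0) sequentially"
    using e_tendsto e_pos by (simp add: filterlim_at less_imp_neq[symmetric])
  have eq: "Y t - Y s = integral {s..t} (\<lambda>r. k / Y r - a * Y r) + \<sigma> * (b t - b s)"
    if st: "s \<le> t" "\<bar>s - x\<bar> \<le> \<delta>" "\<bar>t - x\<bar> \<le> \<delta>" for s t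
  proof -
    have near: "\<bar>r - x\<bar> \<le> \<delta>" "0 \<le> r" "r \<le> x + \<delta>" if "r \<in> {s..t}" for r
      using that st c(3) by auto
    have yn: "(\<lambda>n. y (e n) r) \<longlonglongrightarrow> Y r" if "0 \<le> r" for r
      using filterlim_compose[OF lim[OF that] e_filter] .
    have "(\<lambda>n. integral {s..t} (\<lambda>r. drift (e n) (y (e n) r)))
        \<longlonglongrightarrow> integral {s..t} (\<lambda>r. k / Y r - a * Y r)"
    proof (rule dominated_convergence(2))
      show "(\<lambda>r. drift (e n) (y (e n) r)) integrable_on {s..t}" for n
        using st(2) c(3) by (intro e_pos integrable_continuous_real drift_cont_on) auto
      show "(\<lambda>_. k / c + a * K) integrable_on {s..t}" by (rule integrable_const_ivl)
      show "norm (drift (e n) (y (e n) r)) \<le> k / c + a * K" if "r \<in> {s..t}" for n r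
      proof -
        have "drift (e n) (y (e n) r) \<le> k / c"
          by (rule drift_le[OF e_pos c(1)]) (rule c(5)[OF e_pos e_le near(1)[OF that]])
        moreover have "- (a * K) \<le> drift (e n) (y (e n) r)"
          by (rule drift_ge[OF e_pos]) (rule K(2)[OF e_pos near(2,3)[OF that]])
        moreover have "0 < k / c" "0 < a * K" using k c(1) a K(1) by simp_all
        ultimately show ?thesis unfolding real_norm_def by linarith
      qed
      show "(\<lambda>n. drift (e n) (y (e n) r)) \<longlonglongrightarrow> k / Y r - a * Y r" if "r \<in> {s..t}" for r
      proof -
        have "0 < Y r" using c(6)[OF near(1)[OF that]] c(1) by simp
        then have "(\<lambda>n. k / (max (y (e n) r) 0 + e n) - a * y (e n) r)
            \<longlonglongrightarrow> k / (max (Y r) 0 + 0) - a * Y r"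
          using near[OF that] by (intro tendsto_intros yn e_tendsto) auto
        then show ?thesis using \<open>0 < Y r\<close> by (simp add: drift_def)
      qed
    qed
    then have "(\<lambda>n. integral {s..t} (\<lambda>r. drift (e n) (y (e n) r)) + \<sigma> * (b t - b s))
        \<longlonglongrightarrow> integral {s..t} (\<lambda>r. k / Y r - a * Y r) + \<sigma> * (b t - b s)"
      by (intro tendsto_add tendsto_const)
    moreover have "y (e n) t - y (e n) s
        = integral {s..t} (\<lambda>r. drift (e n) (y (e n) r)) + \<sigma> * (b t - b s)" for n
      using st near[of s] by (intro y_increment e_pos) auto
    ultimately have "(\<lambda>n. y (e n) t - y (e n) s)
        \<longlonglongrightarrow> integral {s..t} (\<lambda>r. k / Y r - a * Y r) + \<sigma> * (b t - b s)"
      by (simp only:)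
    moreover have "(\<lambda>n. y (e n) t - y (e n) s) \<longlonglongrightarrow> Y t - Y s"
      using st near[of s] by (intro tendsto_diff yn) auto
    ultimately show ?thesis using LIMSEQ_unique by blast
  qed
  have pos: "0 < Y r" if "\<bar>r - x\<bar> \<le> \<delta>" for r using c(6)[OF that] c(1) by simp
  show ?thesis
  proof (rule that)
    show "0 < \<delta>" "\<delta> < x" by fact+
  qed (fact pos, fact eq)
qed

text \<open>Without the noise, the local equation presents \<open>Y\<close> up to a constant as the
  integral of a function that is continuous near \<open>x\<close>.\<close>

lemma Y_minus_noise_has_derivative:
  assumes x: "0 < x" "0 < Y x"
  shows "((\<lambda>t. Y t - \<sigma> * b t) has_real_derivative k / Y x - a * Y x) (at x)"
proof -
  obtain \<delta> where \<delta>: "0 < \<delta>" "\<delta> < x" "\<And>r. \<bar>r - x\<bar> \<le> \<delta> \<Longrightarrow> 0 < Y r"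
    "\<And>s t. s \<le> t \<Longrightarrow> \<bar>s - x\<bar> \<le> \<delta> \<Longrightarrow> \<bar>t - x\<bar> \<le> \<delta> \<Longrightarrow>
       Y t - Y s = integral {s..t} (\<lambda>r. k / Y r - a * Y r) + \<sigma> * (b t - b s)"
    by (rule Y_local_equation[OF x]) (rule that)
  let ?u = "x - \<delta>" and ?v = "x + \<delta>"
  let ?f = "\<lambda>r. k / Y r - a * Y r"
  have pos: "0 < Y r" if "r \<in> {?u..?v}" for r using \<delta>(3)[of r] that by auto
  have "continuous_on {?u..?v} Y"
    using pos \<delta>(2) by (intro continuous_at_imp_continuous_on ballI Y_isCont) auto
  then have "continuous_on {?u..?v} ?f"
    using pos by (intro continuous_intros) (auto simp: less_imp_neq[symmetric])
  then have "((\<lambda>t. integral {?u..t} ?f) has_real_derivative ?f x) (at x within {?u..?v})"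
    using \<delta>(1) by (intro integral_has_real_derivative) auto
  then have "((\<lambda>t. integral {?u..t} ?f + (Y ?u - \<sigma> * b ?u)) has_real_derivative ?f x) (at x within {?u..?v})"
    by (auto intro!: derivative_eq_intros)
  then have "((\<lambda>t. Y t - \<sigma> * b t) has_real_derivative ?f x) (at x within {?u..?v})"
  proof (rule has_field_derivative_transform_within[OF _ zero_less_one])
    show "x \<in> {?u..?v}" using \<delta>(1) by auto
    show "integral {?u..t} ?f + (Y ?u - \<sigma> * b ?u) = Y t - \<sigma> * b t" if "t \<in> {?u..?v}" for t
      using \<delta>(4)[of ?u t] that \<delta>(1) by (auto simp: algebra_simps)
  qed
  then show ?thesis
    using \<delta>(1) by (simp add: at_within_Icc_at)
qed

section \<open>One-sided limits at zeros of the limit path\<close>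

text \<open>All penalised paths are at most zero at \<alpha>, and the time they need to climb to
  \<open>\<eta> / 2\<close> is bounded below uniformly in \<epsilon>. The upper bound therefore
  passes to \<open>Y\<close>, and \<open>Y_nonneg\<close> supplies the lower one.\<close>

lemma Y_tendsto_right:
  assumes \<alpha>: "0 \<le> \<alpha>" "Y \<alpha> \<le> 0"
  shows "(Y \<longlongrightarrow> 0) (at_right \<alpha>)"
proof (rule tendstoI)
  fix \<eta> :: real assume \<eta>: "0 < \<eta>"
  obtain \<delta> where \<delta>: "0 < \<delta>" "\<And>r. 0 \<le> r \<Longrightarrow> \<bar>r - \<alpha>\<bar> < \<delta> \<Longrightarrow> \<sigma> * \<bar>b r - b \<alpha>\<bar> < \<eta> / 16"
    using b_continuity[of \<alpha> "\<eta> / 16"] \<alpha> \<eta> by auto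
  \<comment> \<open>Within time \<open>h\<close> the drift above \<open>\<eta> / 4\<close> adds at
    most \<open>\<eta> / 8\<close>, and the noise, compared with its value at \<alpha> twice, less
    than \<open>2 * \<eta> / 16\<close>. Together this is short of the \<open>\<eta> / 4\<close>
    needed to reach \<open>\<eta> / 2\<close>.\<close>
  define h where "h = min \<delta> (\<eta>\<^sup>2 / (32 * k))"
  have h: "0 < h" "h \<le> \<delta>" "h \<le> \<eta>\<^sup>2 / (32 * k)" using \<delta> \<eta> k by (auto simp: h_def)
  have bd: "y \<epsilon> t \<le> \<eta> / 2" if t: "0 < \<epsilon>" "\<alpha> < t" "t < \<alpha> + h" for \<epsilon> t
  proof (rule ccontr)
    assume big: "\<not> y \<epsilon> t \<le> \<eta> / 2"
    have "y \<epsilon> \<alpha> \<le> \<eta> / 4" using y_le_Y[OF that(1) \<alpha>(1)] \<alpha> \<eta> by simp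
    then obtain u where u: "\<alpha> \<le> u" "u \<le> t" "y \<epsilon> u = \<eta> / 4"
      "\<And>r. u \<le> r \<Longrightarrow> r \<le> t \<Longrightarrow> \<eta> / 4 \<le> y \<epsilon> r"
      using last_passage_below[of \<alpha> t "y \<epsilon>" "\<eta> / 4"] big t \<alpha> \<eta> y_cont_on[of \<epsilon> \<alpha> t] by auto
    have "drift \<epsilon> (y \<epsilon> r) \<le> k / (\<eta> / 4)" if "u \<le> r" "r \<le> t" for r
      using u(4)[OF that] \<eta> \<open>0 < \<epsilon>\<close> by (intro drift_le) auto
    then have "y \<epsilon> t - \<eta> / 4 \<le> k / (\<eta> / 4) * (t - u) + \<sigma> * (b t - b u)"
      using y_increment_le[of \<epsilon> u t "k / (\<eta> / 4)"] u that \<alpha> by auto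
    also have "k / (\<eta> / 4) * (t - u) \<le> k / (\<eta> / 4) * (\<eta>\<^sup>2 / (32 * k))"
      using h u that k \<eta> by (intro mult_left_mono) auto
    also have "\<dots> = \<eta> / 8" using k \<eta> by (simp add: field_simps power2_eq_square)
    also have "\<sigma> * (b t - b u) \<le> \<sigma> * \<bar>b t - b \<alpha>\<bar> + \<sigma> * \<bar>b u - b \<alpha>\<bar>"
      unfolding distrib_left[symmetric] using \<sigma> by (intro mult_left_mono) auto
    also have "\<dots> < \<eta> / 8"
      using \<delta>(2)[of t] \<delta>(2)[of u] u that h \<alpha> by auto
    finally show False using big by simp
  qed
  have half: "Y t \<le> \<eta> / 2" if "\<alpha> < t" "t < \<alpha> + h" for t
    using bd that \<alpha> by (intro Y_le) auto
  have "dist (Y t) 0 < \<eta>" if "\<alpha> < t" "t < \<alpha> + h" for t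
  proof -
    have "0 \<le> Y t" using that \<alpha> by (intro Y_nonneg) simp
    with half[OF that] \<eta> show ?thesis by simp
  qed
  then show "\<forall>\<^sub>F t in at_right \<alpha>. dist (Y t) 0 < \<eta>"
    unfolding eventually_at_right_field using h by (intro exI[of _ "\<alpha> + h"]) auto
qed

text \<open>As \<open>Y\<close> is at most zero at \<beta>, \<open>Y_increment_ge\<close> between
  \<open>t\<close> and \<beta> squeezes \<open>Y t\<close> between zero and a function that vanishes
  at \<beta>.\<close>

lemma Y_tendsto_left:
  assumes \<beta>: "0 < \<beta>" "Y \<beta> \<le> 0"
  shows "(Y \<longlongrightarrow> 0) (at_left \<beta>)"
proof -
  obtain K where K: "0 < K" "\<And>\<epsilon> t. 0 < \<epsilon> \<Longrightarrow> 0 \<le> t \<Longrightarrow> t \<le> \<beta> \<Longrightarrow> y \<epsilon> t \<le> K"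
    using y_bounded_above by blast
  let ?g = "\<lambda>t. a * K * (\<beta> - t) - \<sigma> * (b \<beta> - b t)"
  have le: "norm (Y t) \<le> ?g t" if "0 < t" "t < \<beta>" for t
    using Y_increment_ge[of t \<beta> \<beta> K] K that \<beta> Y_nonneg[of t] by auto
  have "continuous_on {0<..} b" by (rule continuous_on_subset[OF b]) auto
  then have "isCont b \<beta>" using \<beta> by (simp add: continuous_on_eq_continuous_at)
  then have "(b \<longlongrightarrow> b \<beta>) (at_left \<beta>)"
    unfolding isCont_def by (rule tendsto_mono[rotated]) (simp add: at_le)
  then have "(?g \<longlongrightarrow> a * K * (\<beta> - \<beta>) - \<sigma> * (b \<beta> - b \<beta>)) (at_left \<beta>)"
    by (intro tendsto_intros)
  then have "(?g \<longlongrightarrow> 0) (at_left \<beta>)" by simp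
  then show ?thesis
    by (rule Lim_null_comparison[rotated])
      (use le \<beta> in \<open>auto simp: eventually_at_left_field intro: exI[of _ 0]\<close>)
qed

lemma Y_eq_zero: "0 \<le> t \<Longrightarrow> Y t \<le> 0 \<Longrightarrow> Y t = 0"
  using Y_nonneg[of t] by simp

section \<open>The equation on one closed component\<close>

context
  fixes \<alpha> \<beta> :: real
  assumes interval: "positivity_interval Y \<alpha> \<beta>"
begin

lemma Y_continuous_on_closed_interval: "continuous_on {\<alpha>..\<beta>} Y"
proof -
  note I = positivity_intervalD[OF interval]
  have Y\<alpha>: "Y \<alpha> = 0" and Y\<beta>: "Y \<beta> = 0" using I by (auto intro: Y_eq_zero)
  have "(Y \<longlongrightarrow> Y x) (at x within {\<alpha>..\<beta>})" if x: "x \<in> {\<alpha>..\<beta>}" for x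
  proof -
    consider "x = \<alpha>" | "x = \<beta>" | "\<alpha> < x" "x < \<beta>" using x by fastforce
    then show ?thesis
    proof cases
      case 1
      then show ?thesis
        using Y_tendsto_right[of \<alpha>] I Y\<alpha> by (simp add: at_within_Icc_at_right)
    next
      case 2
      then show ?thesis
        using Y_tendsto_left[of \<beta>] I Y\<beta> by (simp add: at_within_Icc_at_left)
    next
      case 3
      then have "isCont Y x" using I by (intro Y_isCont) auto
      then show ?thesis by (simp add: isCont_def tendsto_within_subset[where S = UNIV])
    qed
  qed
  then show ?thesis by (simp add: continuous_on_def)
qed

lemma Y_equation:
  assumes t: "t \<in> {\<alpha>..\<beta>}"
  shows "set_integrable lborel {\<alpha>..t} (\<lambda>s. k / Y s)"
    and "set_integrable lborel {\<alpha>..t} Y"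
    and "Y t = (LBINT s:{\<alpha>..t}. k / Y s) - a * (LBINT s:{\<alpha>..t}. Y s) + \<sigma> * (b t - b \<alpha>)"
proof -
  note I = positivity_intervalD[OF interval]
  have Y\<alpha>: "Y \<alpha> = 0" using I by (auto intro: Y_eq_zero)
  have contY: "continuous_on {\<alpha>..t} Y"
    using t by (intro continuous_on_subset[OF Y_continuous_on_closed_interval]) auto
  show intY: "set_integrable lborel {\<alpha>..t} Y"
    by (rule borel_integrable_atLeastAtMost'[OF contY])
  let ?f = "\<lambda>r. k / Y r - a * Y r" and ?F = "\<lambda>r. Y r - \<sigma> * b r"
  have "continuous_on {\<alpha>..t} ?F" using I by (intro continuous_intros contY b_cont_on)
  moreover have "(?F has_vector_derivative ?f r) (at r)" if "r \<in> {\<alpha><..<t}" for r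
    using Y_minus_noise_has_derivative[of r] I(1,3) that t
    by (simp add: has_real_derivative_iff_has_vector_derivative)
  ultimately have f: "(?f has_integral (?F t - ?F \<alpha>)) {\<alpha>..t}"
    using t by (intro fundamental_theorem_of_calculus_interior) auto
  have aY: "((\<lambda>r. a * Y r) has_integral a * integral {\<alpha>..t} Y) {\<alpha>..t}"
    using integrable_continuous_real[OF contY]
    by (intro has_integral_mult_right integrable_integral)
  \<comment> \<open>Adding back the integrable linear term isolates the singular one, whose integral
    is thereby known to be finite.\<close>
  have kY: "((\<lambda>r. k / Y r) has_integral (?F t - ?F \<alpha> + a * integral {\<alpha>..t} Y)) {\<alpha>..t}"
    using has_integral_add[OF f aY] by simp
  \<comment> \<open>For a nonnegative function Henstock-Kurzweil integrability is already absolute.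
    At zeros of \<open>Y\<close> the quotient is 0 by convention.\<close>
  have "(\<lambda>r. k / Y r) absolutely_integrable_on {\<alpha>..t}"
    using kY k I(1) Y_nonneg by (intro nonnegative_absolutely_integrable_1) auto
  \<comment> \<open>Absolute integrability refers to the completed measure; Borel measurability
    brings it back to \<open>lborel\<close>.\<close>
  moreover have "(\<lambda>r. indicator {\<alpha>..t} r *\<^sub>R (k / Y r)) \<in> borel_measurable lborel"
  proof -
    have "(\<lambda>r. indicator {\<alpha>..t} r *\<^sub>R Y r) \<in> borel_measurable borel"
      by (rule borel_measurable_continuous_on_indicator[OF _ contY]) simp
    then have "(\<lambda>r. k / (indicator {\<alpha>..t} r *\<^sub>R Y r)) \<in> borel_measurable borel"
      by measurable
    \<comment> \<open>Outside the interval both sides are 0, the left one because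
      \<open>k / 0 = 0\<close>.\<close>
    also have "(\<lambda>r. k / (indicator {\<alpha>..t} r *\<^sub>R Y r)) = (\<lambda>r. indicator {\<alpha>..t} r *\<^sub>R (k / Y r))"
      by (auto simp: indicator_def)
    finally show ?thesis by simp
  qed
  ultimately show int_kY: "set_integrable lborel {\<alpha>..t} (\<lambda>s. k / Y s)"
    unfolding set_integrable_def by (simp add: integrable_completion)
  show "Y t = (LBINT s:{\<alpha>..t}. k / Y s) - a * (LBINT s:{\<alpha>..t}. Y s) + \<sigma> * (b t - b \<alpha>)"
    using set_borel_integral_eq_integral(2)[OF int_kY] set_borel_integral_eq_integral(2)[OF intY]
      integral_unique[OF kY] Y\<alpha>
    by (simp add: algebra_simps)
qed

end

end

section \<open>From single paths to the almost sure statement\<close>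

theorem theorem3p2:
  fixes M :: "'w measure"
    and H Y0 k a \<sigma> :: real
    and B :: "real \<Rightarrow> 'w \<Rightarrow> real"
    and Yeps :: "real \<Rightarrow> real \<Rightarrow> 'w \<Rightarrow> real"
    and Y :: "real \<Rightarrow> 'w \<Rightarrow> real"
  assumes "prob_space M"
    and "0 < H" "H < 1/2"
    and "0 < Y0" "0 < k" "0 < a" "0 < \<sigma>"
    and "fractional_brownian_motion M H B"
    and "\<And>\<epsilon> \<omega>. 0 < \<epsilon> \<Longrightarrow> \<omega> \<in> space M \<Longrightarrow>
           eps_solution Y0 k a \<sigma> \<epsilon> (\<lambda>t. B t \<omega>) (\<lambda>t. Yeps \<epsilon> t \<omega>)"
    and "AE \<omega> in M. \<forall>t\<ge>0. ((\<lambda>\<epsilon>. Yeps \<epsilon> t \<omega>) \<longlongrightarrow> Y t \<omega>) (at_right 0)"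
  shows "AE \<omega> in M. \<forall>\<alpha> \<beta>. positivity_interval (\<lambda>t. Y t \<omega>) \<alpha> \<beta> \<longrightarrow>
           ((\<lambda>t. Y t \<omega>) \<longlongrightarrow> 0) (at_right \<alpha>) \<and>
           ((\<lambda>t. Y t \<omega>) \<longlongrightarrow> 0) (at_left \<beta>) \<and>
           (\<forall>t\<in>{\<alpha>..\<beta>}.
              set_integrable lborel {\<alpha>..t} (\<lambda>s. k / Y s \<omega>) \<and>
              set_integrable lborel {\<alpha>..t} (\<lambda>s. Y s \<omega>) \<and>
              Y t \<omega> = (LBINT s:{\<alpha>..t}. k / Y s \<omega>)
                    - a * (LBINT s:{\<alpha>..t}. Y s \<omega>)
                    + \<sigma> * (B t \<omega> - B \<alpha> \<omega>))"
  using assms(10) AE_space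
proof eventually_elim
  case (elim \<omega>)
  \<comment> \<open>The only exceptional outcomes are those where the limit fails, so one null set
    serves all intervals and all times at once.\<close>
  interpret penalised_path k a \<sigma> Y0 "\<lambda>t. B t \<omega>" "\<lambda>\<epsilon> t. Yeps \<epsilon> t \<omega>" "\<lambda>t. Y t \<omega>"
    using assms(4-9) elim by unfold_locales (auto simp: fractional_brownian_motion_def)
  show ?case
  proof (intro allI impI conjI ballI)
    fix \<alpha> \<beta> assume I: "positivity_interval (\<lambda>t. Y t \<omega>) \<alpha> \<beta>"
    note ID = positivity_intervalD[OF I]
    show "((\<lambda>t. Y t \<omega>) \<longlongrightarrow> 0) (at_right \<alpha>)" using ID by (intro Y_tendsto_right) auto
    show "((\<lambda>t. Y t \<omega>) \<longlongrightarrow> 0) (at_left \<beta>)" using ID by (intro Y_tendsto_left) auto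
    fix t assume t: "t \<in> {\<alpha>..\<beta>}"
    note E = Y_equation[OF I t]
    show "set_integrable lborel {\<alpha>..t} (\<lambda>s. k / Y s \<omega>)" by (rule E(1))
    show "set_integrable lborel {\<alpha>..t} (\<lambda>s. Y s \<omega>)" by (rule E(2))
    show "Y t \<omega> = (LBINT s:{\<alpha>..t}. k / Y s \<omega>) - a * (LBINT s:{\<alpha>..t}. Y s \<omega>)
        + \<sigma> * (B t \<omega> - B \<alpha> \<omega>)" by (rule E(3))
  qed
qed

end
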